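(* Let $n\ge2$ with $\alpha>8$, fix a feasible four-size profile on $n$ vertices, let $P$ be a block matching, and write $\mathbf m=(m_e)_{e\in P}$. If $\rho_\Sigma\le1$, then $$\sum_{\substack{h_e\in\mathbb N_0\ (e\in P)\\ m_e-h_e>R_0\text{ for every }e}}w(P,\mathbf m-h)\le w_{\mathrm{full}}(P)\,\bigl(1+(\alpha+1)\rho_\Sigma\bigr)^{|P|}.$$
   Context: Let $\alpha:=\lfloor 2\log_2 n-2\log_2\log_2 n+2\log_2(\mathrm e/2)+1\rfloor$. A feasible four-size profile on $n$ vertices consists of nonnegative integers $\kappa_0,\dots,\kappa_3$ with $\sum_{i=0}^3\kappa_iu_i=n$, where $u_i:=\alpha-2-i$. Take two sides (rows and columns), each with $\kappa_i$ labeled slots (blocks) of size $u_i$ for $0\le i\le3$. A block matching $P$ is a set of pairs $e=(a,b)$ (row slot, column slot), called cells, no two of which share a slot. For $e\in P$ let $s_e,t_e$ be the sizes of its row and column slots and $m_e:=\min\{s_e,t_e\}$. $U:=\alpha-2$ and $R_0:=\lfloor U/2\rfloor$. $(x)_r=x(x-1)\cdots(x-r+1)$ is the falling factorial; $g(0)=g(1)=g(2)=1$, $g(x)=2^{\binom x2-1}$ for $x\ge3$. For $j=(j_e)_{e\in P}$ with $0\le j_e\le m_e$ and $J=\sum_ej_e$, $$w(P,j):=\frac{\prod_{e\in P}(s_e)_{j_e}(t_e)_{j_e}}{(n)_J\prod_{e\in P}j_e!}\prod_{e\in P}g(j_e),\qquad w_{\mathrm{full}}(P):=w(P,\mathbf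 m).$$ For $0\le i,j\le3$ put $m_{ij}:=\min\{u_i,u_j\}$, $\rho_{ij}:=n\,m_{ij}\,2^{-\lfloor(3m_{ij}-1)/4\rfloor}$, $\rho_\Sigma:=\sum_{i,j=0}^3\rho_{ij}$. *)

theory Defs
  imports Complex_Main "HOL-Library.FuncSet"
begin

definition alpha :: "nat \<Rightarrow> int" where
  "alpha n = \<lfloor>2 * log 2 (real n) - 2 * log 2 (log 2 (real n)) + 2 * log 2 (exp 1 / 2) + 1\<rfloor>"

text \<open>Block sizes, \<open>U\<close> and \<open>R\<^sub>0\<close> are natural numbers; the truncation by \<open>nat\<close> is
  harmless as soon as \<open>alpha n > 8\<close> (and \<open>i \<le> 3\<close>).\<close>

definition block_size :: "nat \<Rightarrow> nat \<Rightarrow> nat" where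
  "block_size n i = nat (alpha n - 2 - int i)"

definition U_max :: "nat \<Rightarrow> nat" where
  "U_max n = nat (alpha n - 2)"

definition R_zero :: "nat \<Rightarrow> nat" where
  "R_zero n = U_max n div 2"

definition feasible_profile :: "nat \<Rightarrow> (nat \<Rightarrow> nat) \<Rightarrow> bool" where
  "feasible_profile n \<kappa> \<longleftrightarrow> (\<Sum>i=0..3. \<kappa> i * block_size n i) = n"

text \<open>A slot \<open>(i, l)\<close> is the \<open>l\<close>-th labeled block of size \<open>u\<^sub>i\<close>. The two sides have the
  same set of labels; a cell is a pair (row slot, column slot), so the sides are
  distinguished by the position in the pair.\<close>

type_synonym slot = "nat \<times> nat"
type_synonym cell = "slot \<times> slot"

definition slots :: "(nat \<Rightarrow> nat) \<Rightarrow> slot set" where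
  "slots \<kappa> = {(i, l). i \<le> 3 \<and> l < \<kappa> i}"

definition block_matching :: "(nat \<Rightarrow> nat) \<Rightarrow> cell set \<Rightarrow> bool" where
  "block_matching \<kappa> P \<longleftrightarrow> P \<subseteq> slots \<kappa> \<times> slots \<kappa> \<and> inj_on fst P \<and> inj_on snd P"

definition row_size :: "nat \<Rightarrow> cell \<Rightarrow> nat" where
  "row_size n e = block_size n (fst (fst e))"

definition col_size :: "nat \<Rightarrow> cell \<Rightarrow> nat" where
  "col_size n e = block_size n (fst (snd e))"

definition cell_min :: "nat \<Rightarrow> cell \<Rightarrow> nat" where
  "cell_min n e = min (row_size n e) (col_size n e)"

definition falling_fact :: "nat \<Rightarrow> nat \<Rightarrow> real" where
  "falling_fact x r = (\<Prod>k<r. real x - real k)"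

definition g :: "nat \<Rightarrow> real" where
  "g x = (if x \<le> 2 then 1 else 2 ^ ((x choose 2) - 1))"

definition weight :: "nat \<Rightarrow> cell set \<Rightarrow> (cell \<Rightarrow> nat) \<Rightarrow> real" where
  "weight n P j =
     (\<Prod>e\<in>P. falling_fact (row_size n e) (j e) * falling_fact (col_size n e) (j e))
       / (falling_fact n (\<Sum>e\<in>P. j e) * (\<Prod>e\<in>P. fact (j e)))
       * (\<Prod>e\<in>P. g (j e))"

definition weight_full :: "nat \<Rightarrow> cell set \<Rightarrow> real" where
  "weight_full n P = weight n P (cell_min n)"

definition size_min :: "nat \<Rightarrow> nat \<Rightarrow> nat \<Rightarrow> nat" where
  "size_min n i j = min (block_size n i) (block_size n j)"

definition rho :: "nat \<Rightarrow> nat \<Rightarrow> nat \<Rightarrow> real" where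
  "rho n i j = real n * real (size_min n i j)
     * 2 powi (- \<lfloor>(3 * real (size_min n i j) - 1) / 4\<rfloor>)"

definition rho_sum :: "nat \<Rightarrow> real" where
  "rho_sum n = (\<Sum>i=0..3. \<Sum>j=0..3. rho n i j)"

text \<open>The families \<open>h = (h\<^sub>e)\<close> indexed by \<open>P\<close> are represented by extensional functions, so that
  each family is counted once. Truncated subtraction is harmless: \<open>m - h > R\<close>
  on natural numbers forces \<open>h < m\<close>.\<close>

definition deficits :: "nat \<Rightarrow> cell set \<Rightarrow> (cell \<Rightarrow> nat) set" where
  "deficits n P = {h \<in> P \<rightarrow>\<^sub>E UNIV. \<forall>e\<in>P. cell_min n e - h e > R_zero n}"

end

theory Submission
  imports Defs
begin

text \<open>Lowering the multiplicity of a cell from \<open>m\<close> to \<open>m - h > R\<^sub>0\<close> multiplies the weight by at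
  most \<open>(n * m * 2 powr - \<lfloor>(3 * m - 1) / 4\<rfloor>) ^ h \<le> rho_sum ^ h\<close>: the falling factorials of the
  cell give \<open>m ^ h\<close>, that of \<open>n\<close> gives \<open>n ^ h\<close>, and \<open>m - h > R\<^sub>0\<close> forces \<open>h < m - h\<close>, so that \<open>g\<close>
  drops by the remaining power of two. This bound is a product over the cells, hence so is
  its sum over all deficit families, and each factor is a truncated geometric series with
  at most \<open>alpha + 1\<close> terms.\<close>

section \<open>Falling factorials and the growth of \<open>g\<close>\<close>

lemma falling_fact_pos: "r \<le> x \<Longrightarrow> 0 < falling_fact x r"
  unfolding falling_fact_def by (intro prod_pos) auto

lemma falling_fact_add:
  "falling_fact x (r + h) = falling_fact x r * (\<Prod>k<h. real x - real (r + k))"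
  by (induction h) (simp_all add: falling_fact_def)

lemma falling_fact_mono:
  assumes "r + h \<le> x"
  shows "falling_fact x r \<le> falling_fact x (r + h)"
proof -
  have "(1::real) \<le> (\<Prod>k<h. real x - real (r + k))"
    using assms by (intro prod_ge_1) auto
  then show ?thesis
    using falling_fact_pos[of r x] assms by (simp add: falling_fact_add)
qed

lemma falling_fact_add_le:
  assumes "r + h \<le> x"
  shows "falling_fact x (r + h) \<le> falling_fact x r * real x ^ h"
proof -
  have "(\<Prod>k<h. real x - real (r + k)) \<le> (\<Prod>k<h. real x)"
    using assms by (intro prod_mono) auto
  then show ?thesis
    using falling_fact_pos[of r x] assms by (simp add: falling_fact_add)
qed

lemma falling_fact_eq_binomial:
  "falling_fact x r = fact r * real (x choose r)"
  by (simp add: falling_fact_def binomial_gbinomial gbinomial_prod_rev atLeast0LessThan)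

lemma g_pos: "0 < g x"
  by (simp add: g_def)

lemma choose_two_add:
  "(k + h) choose 2 = (k choose 2) + k * h + (h choose 2)"
  by (induction h) (simp_all add: numeral_2_eq_2)

text \<open>Lowering \<open>k + h\<close> to \<open>k\<close> lowers the binomial coefficient by \<open>k + (h - 1) / 2\<close> per unit
  of \<open>h\<close>, and \<open>h < k\<close> makes this at least \<open>(3 * (k + h) - 1) / 4\<close>.\<close>

lemma g_add_ge:
  assumes "3 \<le> k" "h < k"
  shows "g k * 2 ^ (h * ((3 * (k + h) - 1) div 4)) \<le> g (k + h)"
proof -
  define F where "F = (3 * (k + h) - 1) div 4"
  have "4 * F \<le> 3 * (k + h) - 1" by (simp add: F_def)
  then have "2 * F \<le> 2 * k + (h - 1)" using assms by (cases h) auto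
  then have "h * (2 * F) \<le> h * (2 * k + (h - 1))" by (rule mult_le_mono2)
  moreover have "2 * (h choose 2) = h * (h - 1)" 
    unfolding choose_two by (rule dvd_mult_div_cancel) auto
  ultimately have *: "h * F \<le> k * h + (h choose 2)" by (simp add: algebra_simps)
  \<comment> \<open>Both exponents of \<open>g\<close> subtract 1 in the naturals; positivity of
    \<open>k choose 2\<close> rules out truncation.\<close>
  have "0 < k choose 2" using assms by (intro zero_less_binomial) auto
  then have "(k choose 2) - 1 + h * F \<le> ((k + h) choose 2) - 1"
    using * unfolding choose_two_add by linarith
  then have "(2::real) ^ ((k choose 2) - 1) * 2 ^ (h * F) \<le> 2 ^ (((k + h) choose 2) - 1)"
    by (simp flip: power_add)
  then show ?thesis using assms by (simp add: g_def F_def)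
qed

section \<open>Weight of a single cell\<close>

definition cell_weight :: "nat \<Rightarrow> nat \<Rightarrow> nat \<Rightarrow> real" where
  "cell_weight s t j = falling_fact s j * falling_fact t j / fact j * g j"

text \<open>Only the falling factorial of \<open>n\<close> couples the cells; once it is split off,
  the rest can be compared cell by cell.\<close>

lemma weight_eq_prod_cell_weight:
  "weight n P j =
     (\<Prod>e\<in>P. cell_weight (row_size n e) (col_size n e) (j e)) / falling_fact n (\<Sum>e\<in>P. j e)"
  by (simp add: weight_def cell_weight_def prod.distrib prod_dividef)

lemma cell_weight_commute: "cell_weight s t j = cell_weight t s j"
  by (simp add: cell_weight_def)

lemma cell_weight_pos:
  assumes "j \<le> s" "j \<le> t"
  shows "0 < cell_weight s t j"
  using falling_fact_pos assms g_pos by (simp add: cell_weight_def)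

text \<open>Price of one unit of deficit within a cell. It is \<open>rho\<close> without the factor
  \<open>n\<close>, which comes from the coupling falling factorial.\<close>

definition deficit_rate :: "nat \<Rightarrow> real" where
  "deficit_rate m = real m / 2 ^ ((3 * m - 1) div 4)"

lemma deficit_rate_nonneg: "0 \<le> deficit_rate m"
  by (simp add: deficit_rate_def)

text \<open>On the smaller side, of size m = k + h, the quotient of falling factorial and factorial
  is m choose h, at most m ^ h. On the larger side the falling factorial only grows with its length,
  and \<open>g_add_ge\<close> supplies the power of two.\<close>

lemma cell_weight_deficit_le:
  assumes "3 \<le> k" "h < k" "k + h = min s t"
  shows "cell_weight s t k \<le> cell_weight s t (k + h) * deficit_rate (k + h) ^ h"
proof -
  have *: "cell_weight m t k \<le> cell_weight m t (k + h) * deficit_rate (k + h) ^ h"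
    if m: "k + h = m" "m \<le> t" for m t
  proof -
    define F where "F = (3 * m - 1) div 4"
    have "falling_fact m k / fact k = real (m choose h)"
      using m by (auto simp: falling_fact_eq_binomial binomial_symmetric[of k "k + h"])
    also have "\<dots> \<le> real m ^ h"
      using binomial_le_pow[of h m] m by (simp flip: of_nat_power)
    finally have 1: "falling_fact m k / fact k \<le> real m ^ h" .
    have 2: "falling_fact t k \<le> falling_fact t m"
      using falling_fact_mono[of k h t] m by simp
    have 3: "g k \<le> g m / 2 ^ (h * F)"
      using g_add_ge[OF assms(1,2)] unfolding m(1) F_def[symmetric] by (simp add: pos_le_divide_eq)
    have nn: "0 \<le> falling_fact m k" "0 \<le> falling_fact t k" "0 \<le> falling_fact t m" "0 \<le> g k"
      using falling_fact_pos[of k m] falling_fact_pos[of k t] falling_fact_pos[of m t] m g_pos[of k]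
      by auto
    have "cell_weight m t k = falling_fact m k / fact k * falling_fact t k * g k"
      by (simp add: cell_weight_def)
    also have "\<dots> \<le> real m ^ h * falling_fact t m * (g m / 2 ^ (h * F))"
      using 1 2 3 nn by (intro mult_mono) auto
    \<comment> \<open>At full multiplicity the quotient \<open>falling_fact m m / fact m\<close>
      equals 1.\<close>
    also have "\<dots> = cell_weight m t m * deficit_rate m ^ h"
      by (simp add: cell_weight_def deficit_rate_def falling_fact_eq_binomial F_def
          power_divide mult.commute flip: power_mult)
    finally show ?thesis using m by simp
  qed
  show ?thesis
  proof (cases "s \<le> t")
    case True
    then show ?thesis using *[of s t] assms by simp
  next
    case False
    then show ?thesis using *[of t s] assms by (simp add: cell_weight_commute[of s t])
  qed
qed

section \<open>Sizes of matched blocks and the quantities \<open>rho\<close>\<close>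

lemma finite_block_matching:
  assumes "block_matching \<kappa> P"
  shows "finite P"
proof -
  have "slots \<kappa> = Sigma {..3} (\<lambda>i. {..<\<kappa> i})" by (auto simp: slots_def)
  then have "finite (slots \<kappa> \<times> slots \<kappa>)" by simp
  then show ?thesis using assms by (auto simp: block_matching_def intro: finite_subset)
qed

text \<open>Each cell is charged to its row slot; distinct cells use distinct rows, whose sizes
  total \<open>n\<close>. This keeps the falling factorials of \<open>n\<close> in the weights
  positive.\<close>

lemma sum_cell_min_le:
  assumes "feasible_profile n \<kappa>" "block_matching \<kappa> P"
  shows "(\<Sum>e\<in>P. cell_min n e) \<le> n"
proof -
  have slots: "slots \<kappa> = Sigma {0..3} (\<lambda>i. {..<\<kappa> i})" by (auto simp: slots_def)
  have "(\<Sum>e\<in>P. cell_min n e) \<le> (\<Sum>e\<in>P. block_size n (fst (fst e)))"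
    by (intro sum_mono) (simp add: cell_min_def row_size_def)
  also have "\<dots> = (\<Sum>a\<in>fst ` P. block_size n (fst a))"
    using assms(2) by (simp add: block_matching_def sum.reindex)
  also have "\<dots> \<le> (\<Sum>a\<in>slots \<kappa>. block_size n (fst a))"
    using assms(2) by (intro sum_mono2) (auto simp: block_matching_def slots)
  also have "\<dots> = (\<Sum>i=0..3. \<Sum>l<\<kappa> i. block_size n i)"
    using sum.Sigma[of "{0..3}" "\<lambda>i. {..<\<kappa> i}" "\<lambda>i l. block_size n i"]
    by (simp add: slots split_def)
  also have "\<dots> = n" using assms(1) by (simp add: feasible_profile_def)
  finally show ?thesis .
qed

text \<open>More than half of U, hence of the cell size, survives, so the deficit is smaller than
  what remains. From \<open>alpha n > 8\<close> follows \<open>R_zero n \<ge> 3\<close>.\<close>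

lemma deficit_bounds:
  assumes "alpha n > 8" "cell_min n e - h > R_zero n"
  shows "3 \<le> cell_min n e - h" "h < cell_min n e - h" "real (cell_min n e) \<le> real_of_int (alpha n)"
proof -
  have *: "cell_min n e \<le> U_max n" "int (U_max n) = alpha n - 2"
    using assms(1) by (auto simp: cell_min_def row_size_def block_size_def U_max_def)
  then show "3 \<le> cell_min n e - h" "h < cell_min n e - h"
    using assms unfolding R_zero_def by linarith+
  show "real (cell_min n e) \<le> real_of_int (alpha n)"
    using * by linarith
qed

lemma rho_eq_deficit_rate:
  assumes "0 < size_min n i j"
  shows "rho n i j = real n * deficit_rate (size_min n i j)"
proof -
  define m where "m = size_min n i j"
  \<comment> \<open>Positivity of m keeps the natural number \<open>3 * m - 1\<close> free of
    truncation.\<close>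
  have "\<lfloor>(3 * real m - 1) / 4\<rfloor> = \<lfloor>real (3 * m - 1) / real 4\<rfloor>"
    using assms by (simp add: m_def of_nat_diff)
  also have "\<dots> = int ((3 * m - 1) div 4)" by (rule floor_divide_of_nat_eq)
  finally have "\<lfloor>(3 * real m - 1) / 4\<rfloor> = int ((3 * m - 1) div 4)" .
  then show ?thesis
    unfolding rho_def deficit_rate_def m_def[symmetric]
    by (simp only: power_int_minus power_int_of_nat divide_inverse mult.assoc)
qed

lemma rho_nonneg: "0 \<le> rho n i j"
  by (simp add: rho_def)

lemma rho_le_rho_sum:
  assumes "i \<le> 3" "j \<le> 3"
  shows "rho n i j \<le> rho_sum n"
proof -
  have "rho n i j \<le> (\<Sum>j=0..3. rho n i j)"
    using assms by (intro member_le_sum) (auto simp: rho_nonneg)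
  also have "\<dots> \<le> rho_sum n" unfolding rho_sum_def
    using assms by (intro member_le_sum) (auto simp: rho_nonneg sum_nonneg)
  finally show ?thesis .
qed

section \<open>All cells together and the sum over deficits\<close>

lemma weight_deficit_le:
  assumes "alpha n > 8" "feasible_profile n \<kappa>" "block_matching \<kappa> P" "h \<in> deficits n P"
  shows "weight n P (\<lambda>e. cell_min n e - h e)
           \<le> weight_full n P * (\<Prod>e\<in>P. (real n * deficit_rate (cell_min n e)) ^ h e)"
proof -
  define m where "m = cell_min n"
  define c where "c e = cell_weight (row_size n e) (col_size n e)" for e
  have h: "3 \<le> m e - h e" "h e < m e - h e" if "e \<in> P" for e
  proof -
    have "cell_min n e - h e > R_zero n" using assms(4) that by (simp add: deficits_def)
    then show "3 \<le> m e - h e" "h e < m e - h e"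
      unfolding m_def by (rule deficit_bounds(1,2)[OF assms(1)])+
  qed
  define J H where "J = (\<Sum>e\<in>P. m e - h e)" and "H = (\<Sum>e\<in>P. h e)"
  have JH: "J + H = (\<Sum>e\<in>P. m e)"
    unfolding J_def H_def sum.distrib[symmetric]
  proof (rule sum.cong)
    fix e assume "e \<in> P"
    then show "m e - h e + h e = m e" using h(2)[of e] by simp
  qed simp
  then have Jn: "J + H \<le> n" using sum_cell_min_le[OF assms(2,3)] by (simp add: m_def)
  have pos: "0 < falling_fact n J" "0 < falling_fact n (J + H)"
    using Jn falling_fact_pos by auto
  have mle: "m e \<le> row_size n e" "m e \<le> col_size n e" for e
    by (auto simp: m_def cell_min_def)
  have "(\<Prod>e\<in>P. c e (m e - h e)) \<le> (\<Prod>e\<in>P. c e (m e) * deficit_rate (m e) ^ h e)"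
  proof (intro prod_mono conjI)
    fix e assume e: "e \<in> P"
    show "0 \<le> c e (m e - h e)"
      unfolding c_def using mle[of e]
      by (intro less_imp_le[OF cell_weight_pos]) (auto intro: diff_le_self[THEN le_trans])
    have "m e - h e + h e = m e" using h[OF e] by simp
    then show "c e (m e - h e) \<le> c e (m e) * deficit_rate (m e) ^ h e"
      using cell_weight_deficit_le[OF h[OF e], of "row_size n e" "col_size n e"]
      by (simp add: c_def m_def cell_min_def)
  qed
  \<comment> \<open>Passing from J to J + H adds H factors, each at most \<open>n\<close>; later
    \<open>n ^ H\<close> is shared out as \<open>n ^ h e\<close> per cell.\<close>
  moreover have "1 / falling_fact n J \<le> real n ^ H / falling_fact n (J + H)"
    using falling_fact_add_le[OF Jn] pos by (simp add: field_simps)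
  moreover have nn: "0 \<le> (\<Prod>e\<in>P. c e (m e) * deficit_rate (m e) ^ h e)"
    unfolding c_def
    by (intro prod_nonneg mult_nonneg_nonneg zero_le_power deficit_rate_nonneg
        less_imp_le cell_weight_pos mle)
  ultimately have "(\<Prod>e\<in>P. c e (m e - h e)) * (1 / falling_fact n J)
      \<le> (\<Prod>e\<in>P. c e (m e) * deficit_rate (m e) ^ h e) * (real n ^ H / falling_fact n (J + H))"
    using pos by (intro mult_mono) auto
  then show ?thesis
    by (simp add: weight_full_def weight_eq_prod_cell_weight c_def m_def[symmetric] J_def[symmetric]
        JH[symmetric] prod.distrib power_mult_distrib H_def power_sum mult_ac)
qed

theorem proposition8p6:
  fixes n :: nat and \<kappa> :: "nat \<Rightarrow> nat" and P :: "cell set"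
  assumes "n \<ge> 2"
    and "alpha n > 8"
    and "feasible_profile n \<kappa>"
    and "block_matching \<kappa> P"
    and "rho_sum n \<le> 1"
  shows "(\<Sum>h\<in>deficits n P. weight n P (\<lambda>e. cell_min n e - h e))
           \<le> weight_full n P * (1 + (real_of_int (alpha n) + 1) * rho_sum n) ^ card P"
proof -
  define m where "m = cell_min n"
  define q where "q e = real n * deficit_rate (m e)" for e
  define A where "A e = {h. m e - h > R_zero n}" for e
  have fin: "finite P" by (rule finite_block_matching[OF assms(4)])
  have A: "A e \<subseteq> {..<m e}" for e by (auto simp: A_def)
  then have finA: "finite (A e)" for e by (rule finite_subset) simp
  have q0: "0 \<le> q e" for e by (simp add: q_def deficit_rate_nonneg)
  have full: "0 \<le> weight_full n P"
    unfolding weight_full_def weight_eq_prod_cell_weight using sum_cell_min_le[OF assms(3,4)]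
    by (intro divide_nonneg_pos prod_nonneg less_imp_le[OF cell_weight_pos] falling_fact_pos)
      (auto simp: cell_min_def)
  have rs0: "0 \<le> rho_sum n" by (simp add: rho_sum_def rho_nonneg sum_nonneg)
  have cell: "(\<Sum>k\<in>A e. q e ^ k) \<le> 1 + (real_of_int (alpha n) + 1) * rho_sum n" if e: "e \<in> P" for e
  \<comment> \<open>An admissible deficit forces \<open>0 < m e\<close>, which identifying
    \<open>q e\<close> with \<open>rho\<close> requires; without one the sum is 0.\<close>
  proof (cases "A e = {}")
    case True
    then show ?thesis using rs0 assms(2) by simp
  next
    case False
    then obtain k where "m e - k > R_zero n" by (auto simp: A_def)
    then have "0 < m e" and ma: "real (m e) \<le> real_of_int (alpha n)"
      using deficit_bounds(3)[OF assms(2), of e k] by (simp_all add: m_def)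
    moreover obtain i i' l l' where "e = ((i, l), (i', l'))" "i \<le> 3" "i' \<le> 3"
      using e assms(4) by (force simp: block_matching_def slots_def)
    moreover have "m e = size_min n i i'"
      using calculation by (simp add: m_def cell_min_def row_size_def col_size_def size_min_def)
    ultimately have q: "q e \<le> rho_sum n"
      using rho_le_rho_sum[of i i' n] by (simp add: q_def rho_eq_deficit_rate)
    have "(\<Sum>k\<in>A e. q e ^ k) \<le> (\<Sum>k<m e. q e ^ k)"
      using A q0 by (intro sum_mono2) auto
    \<comment> \<open>Since \<open>q e \<le> rho_sum n \<le> 1\<close>, every power with k > 0 is at
      most \<open>q e\<close>, so the geometric series is bounded termwise by
      \<open>rho_sum n\<close>, apart from the leading 1.\<close>
    also have "\<dots> \<le> (\<Sum>k<m e. (if k = 0 then 1 else 0) + rho_sum n)"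
    proof (rule sum_mono)
      fix k
      show "q e ^ k \<le> (if k = 0 then 1 else 0) + rho_sum n"
        using q q0[of e] rs0 assms(5) power_le_one[of "q e" "k - 1"]
          mult_left_le[of "q e ^ (k - 1)" "q e"]
        by (cases k) auto
    qed
    also have "\<dots> = 1 + real (m e) * rho_sum n"
      using \<open>0 < m e\<close> by (simp add: sum.distrib)
    also have "\<dots> \<le> 1 + (real_of_int (alpha n) + 1) * rho_sum n"
      using ma rs0 by (intro add_left_mono mult_right_mono) auto
    finally show ?thesis .
  qed
  \<comment> \<open>The constraint is imposed on each cell separately, so the deficit families form
    a product set and the sum of products factors.\<close>
  have deficits: "deficits n P = Pi\<^sub>E P A"
    by (auto simp: deficits_def A_def m_def PiE_def)
  have "(\<Sum>h\<in>deficits n P. weight n P (\<lambda>e. cell_min n e - h e))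
      \<le> (\<Sum>h\<in>deficits n P. weight_full n P * (\<Prod>e\<in>P. q e ^ h e))"
    using weight_deficit_le[OF assms(2-4)] by (intro sum_mono) (simp add: q_def m_def)
  also have "\<dots> = weight_full n P * (\<Prod>e\<in>P. \<Sum>k\<in>A e. q e ^ k)"
    unfolding deficits by (simp add: prod_sum_PiE[OF fin finA] sum_distrib_left)
  also have "\<dots> \<le> weight_full n P * (\<Prod>e\<in>P. 1 + (real_of_int (alpha n) + 1) * rho_sum n)"
    using cell q0 full by (intro mult_left_mono prod_mono) (auto simp: sum_nonneg)
  finally show ?thesis by simp
qed

end
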